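(* For all integers $s,t\ge 0$ and every integer $r\ge 1$, the sequence $(D(n,r,s,t))_{n=1}^\infty$, where $$D(n,r,s,t)=\sum_{k=0}^n \binom{n}{k}^r\binom{2k}{k}^s\binom{2(n-k)}{n-k}^t,$$ is realizable.
   Context: A sequence $a=(a(n))_{n=1}^\infty$ of non-negative integers is called realizable if one of the following two equivalent conditions holds: (1) there is a self-map $T:X\to X$ on a set $X$ such that $a(n)=\#\{x\in X: T^n(x)=x\}$ for all $n\ge 1$; (2) for all $n\ge 1$, $(\mu*a)(n)=\sum_{d\mid n}\mu(n/d)\,a(d)$ is a non-negative integer divisible by $n$, where $\mu$ is the classical Möbius function and $*$ is Dirichlet convolution. *)

theory Defs
  imports "HOL-Computational_Algebra.Computational_Algebra" "HOL-Library.Countable"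
begin

definition moebius_mu :: "nat \<Rightarrow> int" where
  "moebius_mu n = (if squarefree n then (-1) ^ card (prime_factors n) else 0)"

definition moebius_conv :: "(nat \<Rightarrow> nat) \<Rightarrow> nat \<Rightarrow> int" where
  "moebius_conv a n = (\<Sum>d | d dvd n. moebius_mu (n div d) * int (a d))"

definition fixpoints :: "('a \<Rightarrow> 'a) \<Rightarrow> 'a set \<Rightarrow> nat \<Rightarrow> 'a set" where
  "fixpoints T X n = {x \<in> X. (T ^^ n) x = x}"

text \<open>The finiteness conjunct is needed because \<^const>\<open>card\<close> is 0 on infinite sets.
  Sequences are indexed from 1, so the value of \<open>a\<close> at 0 is irrelevant.\<close>

definition realizes :: "('a \<Rightarrow> 'a) \<Rightarrow> 'a set \<Rightarrow> (nat \<Rightarrow> nat) \<Rightarrow> bool" where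
  "realizes T X a \<longleftrightarrow> T ` X \<subseteq> X \<and>
     (\<forall>n\<ge>1. finite (fixpoints T X n) \<and> card (fixpoints T X n) = a n)"

text \<open>An existential over arbitrary carrier types is not expressible inside HOL. Taking subsets
  of \<^typ>\<open>nat\<close> loses nothing: \<open>realizes_imp_realizable\<close> below shows that a realization on any
  type yields one on \<^typ>\<open>nat\<close>, and \<open>realizable_iff_moebius_conv\<close> gives the equivalent
  arithmetic characterization through the Moebius function.\<close>

definition realizable :: "(nat \<Rightarrow> nat) \<Rightarrow> bool" where
  "realizable a \<longleftrightarrow> (\<exists>(T :: nat \<Rightarrow> nat) X. realizes T X a)"

definition D :: "nat \<Rightarrow> nat \<Rightarrow> nat \<Rightarrow> nat \<Rightarrow> nat" where
  "D n r s t = (\<Sum>k=0..n. (n choose k) ^ r * ((2 * k) choose k) ^ s *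
     ((2 * (n - k)) choose (n - k)) ^ t)"

lemma sum_Pow_neg_one:
  assumes "finite A"
  shows "(\<Sum>B\<in>Pow A. (-1) ^ card B) = (if A = {} then 1 else 0 :: int)"
  using assms
proof (induction A rule: finite_induct)
  case (insert x A)
  have "(\<Sum>B\<in>Pow (insert x A). (-1) ^ card B) =
     (\<Sum>B\<in>Pow A. (-1) ^ card B) + (\<Sum>B\<in>insert x ` Pow A. (-1) ^ card B :: int)"
    unfolding Pow_insert using insert by (intro sum.union_disjoint) auto
  also have "(\<Sum>B\<in>insert x ` Pow A. (-1) ^ card B :: int) =
     (\<Sum>B\<in>Pow A. (-1) ^ card (insert x B))"
  proof (subst sum.reindex)
    show "inj_on (insert x) (Pow A)" using insert by (auto simp: inj_on_def)
  qed auto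
  also have "\<dots> = (\<Sum>B\<in>Pow A. - ((-1) ^ card B))"
  proof (rule sum.cong, goal_cases)
    case (2 B)
    then have "finite B" "x \<notin> B" using insert by (auto intro: finite_subset)
    then show ?case by simp
  qed simp
  finally show ?case by (simp add: sum_negf)
qed simp

lemma prime_factors_prod_primes:
  fixes A :: "nat set"
  assumes "finite A" "\<And>p. p \<in> A \<Longrightarrow> prime p"
  shows "prime_factors (\<Prod>A) = A" "squarefree (\<Prod>A)"
proof -
  have "(\<Union>p\<in>A. prime_factors p) = A"
    using assms(2) by (auto simp: prime_factorization_prime)
  moreover have "0 \<notin> A" using assms(2) not_prime_0 by blast
  ultimately show "prime_factors (\<Prod>A) = A"
    using prime_factors_prod[of A "\<lambda>p. p"] assms(1) by simp
  show "squarefree (\<Prod>A)"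
    by (rule squarefree_prod_coprime) (auto intro: primes_coprime squarefree_prime assms)
qed

lemma squarefree_eq_prod_prime_factors:
  fixes d :: nat
  assumes "squarefree d"
  shows "\<Prod>(prime_factors d) = d"
proof -
  have "d \<noteq> 0" using assms not_squarefree_0 by metis
  then have "d = (\<Prod>p\<in>prime_factors d. p ^ multiplicity p d)"
    by (simp add: prime_factorization_nat)
  also have "\<dots> = \<Prod>(prime_factors d)"
    using squarefree_factorial_semiring'[OF \<open>d \<noteq> 0\<close>] assms by (intro prod.cong) auto
  finally show ?thesis ..
qed

lemma sum_moebius_mu:
  assumes "n > 0"
  shows "(\<Sum>d | d dvd n. moebius_mu d) = (if n = 1 then 1 else 0)"
proof -
  have fin: "finite {d. d dvd n}" using assms by simp
  have "(\<Sum>d | d dvd n. moebius_mu d) =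
      (\<Sum>d | d dvd n \<and> squarefree d. (-1) ^ card (prime_factors d))"
    unfolding moebius_mu_def using fin by (simp add: sum.inter_filter[symmetric])
  also have "\<dots> = (\<Sum>B\<in>Pow (prime_factors n). (-1) ^ card B)"
  proof (rule sum.reindex_bij_witness[where i = "\<lambda>B. \<Prod>B" and j = prime_factors], goal_cases)
    case (1 d) then show ?case by (simp add: squarefree_eq_prod_prime_factors)
  next
    case (2 d) then show ?case using assms dvd_prime_factors[of n d] by simp
  next
    case (3 B)
    then show ?case by (intro prime_factors_prod_primes) (auto intro: finite_subset)
  next
    case (4 B)
    then have B: "finite B" "\<And>p. p \<in> B \<Longrightarrow> prime p" "B \<subseteq> prime_factors n"
      by (auto intro: finite_subset)
    have "\<Prod>B dvd \<Prod>(prime_factors n)"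
      by (rule prod_dvd_prod_subset) (use B in auto)
    also have "\<dots> dvd (\<Prod>p\<in>prime_factors n. p ^ multiplicity p n)"
      by (rule prod_dvd_prod) (auto simp: prime_factors_multiplicity)
    also have "\<dots> = n" using assms by (simp add: prime_factorization_nat[symmetric])
    finally show ?case using B(1,2) prime_factors_prod_primes(2)[of B] by auto
  next
    case (5 d) then show ?case by simp
  qed
  also have "\<dots> = (if n = 1 then 1 else 0)"
  proof -
    have "prime_factors n = {} \<longleftrightarrow> n = 1"
      using assms by (auto simp: prime_factorization_empty_iff)
    then show ?thesis by (subst sum_Pow_neg_one) auto
  qed
  finally show ?thesis .
qed

lemma sum_moebius_conv:
  assumes "n > 0"
  shows "(\<Sum>d | d dvd n. moebius_conv a d) = int (a n)"
proof -
  have fin: "finite {d. d dvd m}" if "m dvd n" for m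
    using that assms by (auto intro: finite_divisors_nat simp: dvd_pos_nat)
  have quot: "n div e dvd n" if "e dvd n" for e
    using that by (metis dvd_mult_div_cancel dvd_triv_right)
  have "(\<Sum>d | d dvd n. moebius_conv a d) =
    (\<Sum>(d, e)\<in>Sigma {d. d dvd n} (\<lambda>d. {e. e dvd d}). moebius_mu (d div e) * int (a e))"
    unfolding moebius_conv_def by (subst sum.Sigma) (auto intro: fin)
  also have "\<dots> = (\<Sum>(e, f)\<in>Sigma {e. e dvd n} (\<lambda>e. {f. f dvd n div e}). moebius_mu f * int (a e))"
  proof (rule sum.reindex_bij_witness[where i = "\<lambda>(e, f). (e * f, e)" and j = "\<lambda>(d, e). (e, d div e)"], goal_cases)
    case (2 x)
    then obtain d e where "x = (d, e)" "d dvd n" "e dvd d" by auto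
    moreover from this obtain f where "d = e * f" by (auto elim: dvdE)
    moreover from calculation have "e > 0" using assms by (auto intro: Nat.gr0I)
    ultimately show ?case by (auto simp: dvd_div_iff_mult mult.commute dvd_mult_left)
  next
    case (3 x)
    then obtain e f where "x = (e, f)" "e dvd n" "f dvd n div e" by auto
    moreover have "e > 0" using \<open>e dvd n\<close> assms by (simp add: dvd_pos_nat)
    ultimately show ?case by simp
  next
    case (4 x)
    then obtain e f where "x = (e, f)" "e dvd n" "f dvd n div e" by auto
    moreover from this have "e > 0" using assms by (auto intro: Nat.gr0I)
    ultimately show ?case by (auto simp: dvd_div_iff_mult mult.commute)
  qed auto
  also have "\<dots> = (\<Sum>e | e dvd n. \<Sum>f | f dvd n div e. moebius_mu f * int (a e))"
    by (subst sum.Sigma) (use fin quot in auto)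
  also have "\<dots> = (\<Sum>e | e dvd n. if e = n then int (a e) else 0)"
  proof (rule sum.cong, goal_cases)
    case (2 e)
    then obtain k where k: "n = e * k" by auto
    then have "e > 0" "k > 0" using assms by auto
    then show ?case using sum_moebius_mu[of k] k by (simp flip: sum_distrib_right)
  qed simp
  also have "\<dots> = int (a n)" using fin[of n] by simp
  finally show ?thesis .
qed

lemma moebius_conv_unique:
  assumes "\<And>n. n > 0 \<Longrightarrow> int (a n) = (\<Sum>d | d dvd n. c d)" "n > 0"
  shows "moebius_conv a n = c n"
  using assms(2)
proof (induction n rule: less_induct)
  case (less n)
  have split: "(\<Sum>d | d dvd n. f d) = f n + (\<Sum>d\<in>{d. d dvd n} - {n}. f d)" for f :: "nat \<Rightarrow> int"
    using less.prems by (intro sum.remove) auto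
  have "(\<Sum>d\<in>{d. d dvd n} - {n}. moebius_conv a d) = (\<Sum>d\<in>{d. d dvd n} - {n}. c d)"
  proof (intro sum.cong refl less.IH)
    fix d assume "d \<in> {d. d dvd n} - {n}"
    then show "d < n" "d > 0" using less.prems by (auto dest: dvd_imp_le simp: dvd_pos_nat)
  qed
  then show ?case
    using split[of "moebius_conv a"] split[of c] sum_moebius_conv[OF less.prems, of a]
      assms(1)[OF less.prems] by simp
qed

definition least_period_points :: "('a \<Rightarrow> 'a) \<Rightarrow> 'a set \<Rightarrow> nat \<Rightarrow> 'a set" where
  "least_period_points T X n = {x \<in> fixpoints T X n. \<forall>m. 0 < m \<longrightarrow> m < n \<longrightarrow> (T ^^ m) x \<noteq> x}"

lemma fixpoints_dvd:
  assumes "d dvd n"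
  shows "fixpoints T X d \<subseteq> fixpoints T X n"
proof
  fix x assume "x \<in> fixpoints T X d"
  then have "x \<in> X" and x: "(T ^^ d) x = x" by (auto simp: fixpoints_def)
  have "n mod d = 0" using assms by simp
  then have "(T ^^ n) x = x" using funpow_mod_eq[OF x, of n] by simp
  with \<open>x \<in> X\<close> show "x \<in> fixpoints T X n" by (simp add: fixpoints_def)
qed

lemma fixpoints_eq_UN:
  assumes "n > 0"
  shows "fixpoints T X n = (\<Union>d\<in>{d. d dvd n}. least_period_points T X d)"
proof (intro equalityI subsetI)
  fix x assume x: "x \<in> fixpoints T X n"
  define d where "d = (LEAST d. 0 < d \<and> (T ^^ d) x = x)"
  have d: "0 < d \<and> (T ^^ d) x = x"
    unfolding d_def by (rule LeastI[of _ n]) (use x assms in \<open>auto simp: fixpoints_def\<close>)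
  have min: "(T ^^ m) x \<noteq> x" if "0 < m" "m < d" for m
    using that not_less_Least[of m "\<lambda>d. 0 < d \<and> (T ^^ d) x = x"] by (auto simp: d_def)
  have "(T ^^ (n mod d)) x = x" using funpow_mod_eq[of d T x n] d x by (simp add: fixpoints_def)
  then have "n mod d = 0" using min[of "n mod d"] d mod_less_divisor[of d n] by blast
  then have "d dvd n" by auto
  moreover have "x \<in> least_period_points T X d"
    using x d min by (auto simp: least_period_points_def fixpoints_def)
  ultimately show "x \<in> (\<Union>d\<in>{d. d dvd n}. least_period_points T X d)" by blast
next
  fix x assume "x \<in> (\<Union>d\<in>{d. d dvd n}. least_period_points T X d)"
  then obtain d where "d dvd n" "x \<in> fixpoints T X d" by (auto simp: least_period_points_def)
  then show "x \<in> fixpoints T X n" using fixpoints_dvd[of d n T X] by (simp add: subset_iff)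
qed

lemma least_period_points_disjoint:
  assumes "d > 0" "e > 0" "d \<noteq> e"
  shows "least_period_points T X d \<inter> least_period_points T X e = {}"
  using assms by (auto simp: least_period_points_def fixpoints_def neq_iff)

lemma dvd_card_least_period_points:
  assumes "T ` X \<subseteq> X" "n > 0" "finite (least_period_points T X n)"
  shows "n dvd card (least_period_points T X n)"
proof -
  let ?P = "least_period_points T X n"
  define orb where "orb x = (\<lambda>i. (T ^^ i) x) ` {..<n}" for x
  have perd: "(T ^^ n) x = x" if "x \<in> ?P" for x
    using that by (auto simp: least_period_points_def fixpoints_def)
  have orb_iff: "y \<in> orb x \<longleftrightarrow> (\<exists>i. y = (T ^^ i) x)" if "x \<in> ?P" for x y
  proof
    assume "\<exists>i. y = (T ^^ i) x"
    then obtain i where "y = (T ^^ i) x" by blast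
    then have "y = (T ^^ (i mod n)) x" by (simp only: funpow_mod_eq[OF perd[OF that]])
    then show "y \<in> orb x" using assms(2) by (auto simp: orb_def)
  qed (auto simp: orb_def)
  have ret: "(T ^^ (n - i)) ((T ^^ i) x) = x" if "x \<in> ?P" "i < n" for x i
    using perd[OF that(1)] that(2) by (simp flip: funpow_add[THEN fun_cong, simplified o_apply])
  have closed: "(T ^^ i) x \<in> ?P" if x: "x \<in> ?P" and i: "i < n" for x i
  proof -
    have inX: "(T ^^ i) x \<in> X" for i
      using x assms(1) by (induction i) (auto simp: least_period_points_def fixpoints_def)
    have comm: "(T ^^ m) ((T ^^ i) x) = (T ^^ i) ((T ^^ m) x)" for m
      by (metis add.commute comp_apply funpow_add)
    have "(T ^^ m) x = x" if m: "(T ^^ m) ((T ^^ i) x) = (T ^^ i) x" for m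
    proof -
      have "(T ^^ (n - i)) ((T ^^ m) ((T ^^ i) x)) = (T ^^ m) ((T ^^ (n - i)) ((T ^^ i) x))"
        by (metis add.commute comp_apply funpow_add)
      then show ?thesis using m ret[OF x i] by simp
    qed
    moreover have "(T ^^ m) x \<noteq> x" if "0 < m" "m < n" for m
      using x that by (simp add: least_period_points_def)
    moreover have "(T ^^ n) ((T ^^ i) x) = (T ^^ i) x" using comm[of n] perd[OF x] by simp
    ultimately show ?thesis
      using inX[of i] unfolding least_period_points_def fixpoints_def by blast
  qed
  have inj: "inj_on (\<lambda>i. (T ^^ i) x) {..<n}" if x: "x \<in> ?P" for x
  proof -
    have False if ij: "i < j" "j < n" "(T ^^ i) x = (T ^^ j) x" for i j
    proof -
      have "(T ^^ (j - i)) ((T ^^ i) x) = (T ^^ i) x"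
        using ij by (metis comp_apply funpow_add le_add_diff_inverse2 less_imp_le)
      moreover have "(T ^^ i) x \<in> ?P" using closed[OF x] ij by simp
      ultimately show False using ij by (auto simp: least_period_points_def)
    qed
    then show ?thesis by (metis (no_types, lifting) inj_onI lessThan_iff linorder_neqE_nat)
  qed
  have eq: "orb y = orb x" if x: "x \<in> ?P" and y: "y \<in> orb x" for x y
  proof -
    obtain i where i: "i < n" "y = (T ^^ i) x" using y by (auto simp: orb_def)
    have yP: "y \<in> ?P" using closed[OF x] i by simp
    have xy: "x = (T ^^ (n - i)) y" using ret[OF x i(1)] i(2) by simp
    show ?thesis
    proof (intro equalityI subsetI)
      fix z assume "z \<in> orb y"
      then obtain j where "z = (T ^^ j) y" using orb_iff[OF yP] by auto
      then have "z = (T ^^ (j + i)) x" using i by (simp add: funpow_add)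
      then show "z \<in> orb x" using orb_iff[OF x] by auto
    next
      fix z assume "z \<in> orb x"
      then obtain j where "z = (T ^^ j) x" using orb_iff[OF x] by auto
      then have "z = (T ^^ (j + (n - i))) y" using xy by (simp add: funpow_add)
      then show "z \<in> orb y" using orb_iff[OF yP] by auto
    qed
  qed
  have "\<Union>(orb ` ?P) = ?P"
  proof (intro equalityI subsetI)
    fix x assume "x \<in> ?P"
    then show "x \<in> \<Union>(orb ` ?P)" using orb_iff[of x x] by (auto intro!: bexI[of _ x] exI[of _ 0])
  qed (auto simp: orb_def closed)
  moreover have "n dvd card (\<Union>(orb ` ?P))"
  proof (rule dvd_partition)
    show "finite (\<Union>(orb ` ?P))" using calculation assms(3) by simp
    show "\<forall>c\<in>orb ` ?P. n dvd card c" by (auto simp: orb_def card_image inj)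
    show "\<forall>c\<in>orb ` ?P. \<forall>d\<in>orb ` ?P. c \<noteq> d \<longrightarrow> c \<inter> d = {}"
      using eq by blast
  qed
  ultimately show ?thesis by simp
qed

lemma realizes_imp_moebius_conv:
  assumes "realizes T X a" "n \<ge> 1"
  shows "moebius_conv a n \<ge> 0 \<and> int n dvd moebius_conv a n"
proof -
  have T: "T ` X \<subseteq> X" and fin: "\<And>n. n \<ge> 1 \<Longrightarrow> finite (fixpoints T X n)"
    and card: "\<And>n. n \<ge> 1 \<Longrightarrow> card (fixpoints T X n) = a n"
    using assms(1) by (auto simp: realizes_def)
  have finL: "finite (least_period_points T X n)" if "n > 0" for n
    by (rule finite_subset[OF _ fin[of n]]) (use that in \<open>auto simp: least_period_points_def\<close>)
  have "moebius_conv a n = int (card (least_period_points T X n))"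
  proof (rule moebius_conv_unique)
    fix n :: nat assume n: "n > 0"
    have "a n = card (\<Union>d\<in>{d. d dvd n}. least_period_points T X d)"
      using n card[of n] fixpoints_eq_UN[OF n, of T X] by simp
    also have "\<dots> = (\<Sum>d | d dvd n. card (least_period_points T X d))"
    proof (rule card_UN_disjoint)
      show "finite {d. d dvd n}" using n by simp
      show "\<forall>d\<in>{d. d dvd n}. finite (least_period_points T X d)"
        using finL n by (auto simp: dvd_pos_nat)
      show "\<forall>d\<in>{d. d dvd n}. \<forall>e\<in>{d. d dvd n}. d \<noteq> e \<longrightarrow>
          least_period_points T X d \<inter> least_period_points T X e = {}"
        using dvd_pos_nat[OF n] by (intro ballI impI least_period_points_disjoint) auto
    qed
    finally show "int (a n) = (\<Sum>d | d dvd n. int (card (least_period_points T X d)))" by simp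
  qed (use assms in simp)
  then show ?thesis
    using dvd_card_least_period_points[OF T _ finL, of n] assms(2) by simp
qed

lemma realizes_inj_image:
  fixes f :: "'a \<Rightarrow> 'b"
  assumes "realizes T X a" "inj f"
  shows "realizes (f \<circ> T \<circ> inv f) (f ` X) a"
proof -
  have pow: "((f \<circ> T \<circ> inv f) ^^ n) (f x) = f ((T ^^ n) x)" for n x
    by (induction n) (simp_all add: assms(2))
  have "fixpoints (f \<circ> T \<circ> inv f) (f ` X) n = f ` fixpoints T X n" for n
    using assms(2) by (auto simp: fixpoints_def pow inj_eq)
  then show ?thesis
    using assms by (auto simp: realizes_def card_image inj_on_subset[OF assms(2)])
qed

lemma moebius_conv_imp_realizes:
  assumes "\<And>n. n \<ge> 1 \<Longrightarrow> moebius_conv a n \<ge> 0 \<and> int n dvd moebius_conv a n"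
  shows "\<exists>(T :: nat \<times> nat \<times> nat \<Rightarrow> nat \<times> nat \<times> nat) X. realizes T X a"
proof -
  define c where "c n = nat (moebius_conv a n) div n" for n
  have c: "int (n * c n) = moebius_conv a n" if "n > 0" for n
    using assms[of n] that by (auto simp: c_def zdiv_int elim!: dvdE)
  define X where "X = {(n, j, i). n > 0 \<and> j < c n \<and> i < n}"
  define T :: "nat \<times> nat \<times> nat \<Rightarrow> nat \<times> nat \<times> nat"
    where "T = (\<lambda>(n, j, i). (n, j, Suc i mod n))"
  have pow: "(T ^^ m) (n, j, i) = (n, j, (i + m) mod n)" if "i < n" for m n j i
    using that by (induction m) (simp_all add: T_def mod_Suc_eq)
  have fp: "fixpoints T X m = Sigma {n. n dvd m} (\<lambda>n. {..<c n} \<times> {..<n})" if "m > 0" for m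
  proof -
    have "(i + m) mod n = i \<longleftrightarrow> n dvd m" if "i < n" for n i
    proof
      assume "(i + m) mod n = i"
      then have "(i + m) mod n = i mod n" using that by simp
      then show "n dvd m" by (metis add_diff_cancel_left' le_add1 mod_eq_dvd_iff_nat)
    next
      assume "n dvd m"
      then show "(i + m) mod n = i" using that by (auto elim!: dvdE)
    qed
    then show ?thesis using that by (auto simp: fixpoints_def X_def pow)
  qed
  have "realizes T X a"
    unfolding realizes_def
  proof (intro conjI allI impI)
    show "T ` X \<subseteq> X" by (auto simp: T_def X_def)
    fix m :: nat assume "m \<ge> 1"
    then have m: "m > 0" by simp
    show "finite (fixpoints T X m)" unfolding fp[OF m] using m by auto
    have "card (fixpoints T X m) = (\<Sum>n | n dvd m. n * c n)"
      unfolding fp[OF m] using m by (simp add: card_SigmaI card_cartesian_product mult.commute)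
    then have "int (card (fixpoints T X m)) = (\<Sum>n | n dvd m. int (n * c n))" by simp
    also have "\<dots> = (\<Sum>n | n dvd m. moebius_conv a n)"
      using m by (intro sum.cong c) (auto simp: dvd_pos_nat)
    also have "\<dots> = int (a m)" by (rule sum_moebius_conv[OF m])
    finally show "card (fixpoints T X m) = a m" by simp
  qed
  then show ?thesis by blast
qed

lemma realizable_iff_moebius_conv:
  "realizable a \<longleftrightarrow> (\<forall>n\<ge>1. moebius_conv a n \<ge> 0 \<and> int n dvd moebius_conv a n)"
proof
  assume "\<forall>n\<ge>1. moebius_conv a n \<ge> 0 \<and> int n dvd moebius_conv a n"
  then obtain T :: "nat \<times> nat \<times> nat \<Rightarrow> nat \<times> nat \<times> nat" and X where "realizes T X a"
    using moebius_conv_imp_realizes by metis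
  from realizes_inj_image[OF this inj_to_nat] show "realizable a"
    unfolding realizable_def by blast
qed (auto simp: realizable_def dest: realizes_imp_moebius_conv)

lemma realizes_imp_realizable: "realizes T X a \<Longrightarrow> realizable a"
  unfolding realizable_iff_moebius_conv using realizes_imp_moebius_conv by blast

end

theory Submission
  imports Defs
begin

text \<open>Words of length \<open>n\<close> over a finite alphabet whose letters carry integer weights, and whose
  total weights vanish, are the \<open>n\<close>-periodic points of a shift: since the integers are torsion-free,
  vanishing of the total weight over one period is equivalent to vanishing over any other. Hence
  their number is realizable. Now \<open>D n r s t\<close> counts such words. A letter records whether its
  position lies in a set \<open>K\<close> of \<open>k\<close> positions, and each further factor
  \<open>(a k + b (n - k)) choose (c k + d (n - k))\<close> is encoded by attaching to a position in \<open>K\<close> a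
  subset of an \<open>a\<close>-element set, with weight its cardinality minus \<open>c\<close>, and similarly with
  \<open>b\<close> and \<open>d\<close> for a position outside \<open>K\<close>. One factor \<open>n choose k\<close> counts the sets \<open>K\<close>, which is
  where \<open>r \<ge> 1\<close> enters.\<close>

text \<open>The range splits into \<open>m\<close> blocks of length \<open>p\<close> with equal
  sums. This serves to compare the total weights of one sequence over two different periods.\<close>

lemma sum_lessThan_mult_periodic:
  fixes f :: "nat \<Rightarrow> int"
  assumes "\<And>i. f (i + p) = f i"
  shows "(\<Sum>i<m * p. f i) = int m * (\<Sum>i<p. f i)"
proof (induction m)
  case (Suc m)
  have per: "f (m * p + i) = f i" for i
  proof (induction m)
    case (Suc m)
    then show ?case using assms[of "m * p + i"] by (simp add: ac_simps)
  qed simp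
  have "(\<Sum>i<N + q. f i) = (\<Sum>i<N. f i) + (\<Sum>i<q. f (N + i))" for N q
    by (induction q) (simp_all add: add.assoc)
  from this[of "m * p" p]
  have "(\<Sum>i<m * p + p. f i) = (\<Sum>i<m * p. f i) + (\<Sum>i<p. f i)" by (simp only: per)
  then show ?case using Suc by (simp add: algebra_simps)
qed simp

text \<open>The realizing map is the left shift on periodic sequences over \<open>A\<close>. Cutting
  a sequence down to its first \<open>n\<close> terms identifies the fixed points of the
  \<open>n\<close>-th iterate with the words counted, and periodic extension is the inverse.\<close>

lemma realizable_zero_sum_words:
  fixes A :: "'b set" and w :: "'j \<Rightarrow> 'b \<Rightarrow> int"
  assumes "finite A"
  shows "realizable (\<lambda>n. card {x \<in> {..<n} \<rightarrow>\<^sub>E A. \<forall>j\<in>J. (\<Sum>i<n. w j (x i)) = 0})"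
proof -
  define T :: "(nat \<Rightarrow> 'b) \<Rightarrow> nat \<Rightarrow> 'b" where "T x = (\<lambda>i. x (Suc i))" for x
  \<comment> \<open>Since \<open>X\<close> must not depend on \<open>n\<close>, zero weight is asked
    over some period \<open>p\<close> only; that it then holds over every period \<open>n\<close> is
    shown below.\<close>
  define X :: "(nat \<Rightarrow> 'b) set" where "X = {x. range x \<subseteq> A \<and>
    (\<exists>p>0. (\<forall>i. x (i + p) = x i) \<and> (\<forall>j\<in>J. (\<Sum>i<p. w j (x i)) = 0))}"
  define Z :: "nat \<Rightarrow> (nat \<Rightarrow> 'b) set" where "Z n = {x \<in> {..<n} \<rightarrow>\<^sub>E A. \<forall>j\<in>J. (\<Sum>i<n. w j (x i)) = 0}" for n
  have pow: "(T ^^ n) x = (\<lambda>i. x (i + n))" for n x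
    by (induction n) (auto simp: T_def)
  have "T ` X \<subseteq> X"
  proof
    fix y assume "y \<in> T ` X"
    then obtain x p where x: "y = T x" "range x \<subseteq> A" "p > 0" "\<And>i. x (i + p) = x i"
        "\<And>j. j \<in> J \<Longrightarrow> (\<Sum>i<p. w j (x i)) = 0"
      unfolding X_def by blast
    \<comment> \<open>Shifting the window by one drops the weight of \<open>x 0\<close> and gains
      that of \<open>x p\<close>, which is the same letter.\<close>
    have "(\<Sum>i<p. w j (y i)) = 0" if "j \<in> J" for j
      using sum.lessThan_Suc_shift[of "\<lambda>i. w j (x i)" p] x(4)[of 0] x(5)[OF that]
      by (simp add: x(1) T_def)
    moreover have "range y \<subseteq> A" "\<And>i. y (i + p) = y i"
      using x(2) x(4)[of "Suc _"] by (auto simp: x(1) T_def)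
    ultimately show "y \<in> X" using x(3) unfolding X_def by blast
  qed
  moreover have "bij_betw (\<lambda>x. restrict x {..<n}) (fixpoints T X n) (Z n)" if n: "n > 0" for n
  proof (rule bij_betw_byWitness[where f' = "\<lambda>y i. y (i mod n)"])
    have per: "x (i mod n) = x i" if x: "x \<in> fixpoints T X n" for x i
    proof -
      have step: "x (i + n) = x i" for i
        using x by (auto simp: fixpoints_def pow dest: fun_cong)
      have "x (i mod n + m * n) = x (i mod n)" for m
      proof (induction m)
        case (Suc m)
        then show ?case using step[of "i mod n + m * n"] by (simp add: ac_simps)
      qed simp
      from this[of "i div n"] show ?thesis by simp
    qed
    then show "\<forall>x\<in>fixpoints T X n. (\<lambda>i. restrict x {..<n} (i mod n)) = x"
      using n by auto
    show "\<forall>y\<in>Z n. restrict (\<lambda>i. y (i mod n)) {..<n} = y"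
      by (auto simp: Z_def PiE_iff extensional_def)
    show "(\<lambda>x. restrict x {..<n}) ` fixpoints T X n \<subseteq> Z n"
    proof clarify
      fix x assume x: "x \<in> fixpoints T X n"
      then obtain p where p: "range x \<subseteq> A" "p > 0" "\<And>i. x (i + p) = x i"
          "\<And>j. j \<in> J \<Longrightarrow> (\<Sum>i<p. w j (x i)) = 0"
        unfolding X_def fixpoints_def by blast
      have "(\<Sum>i<n. w j (x i)) = 0" if "j \<in> J" for j
      proof -
        have "x (i + n) = x i" for i
          using x by (auto simp: fixpoints_def pow dest: fun_cong)
        \<comment> \<open>Both sides are the sum over the first \<open>n * p\<close> terms, cut into
          \<open>p\<close> blocks of length \<open>n\<close> or into \<open>n\<close> blocks of
          length \<open>p\<close>. The right side vanishes, and the positive factor \<open>p\<close>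
          cancels in the integers.\<close>
        then have "int p * (\<Sum>i<n. w j (x i)) = int n * (\<Sum>i<p. w j (x i))"
          using sum_lessThan_mult_periodic[of "\<lambda>i. w j (x i)" n p]
            sum_lessThan_mult_periodic[of "\<lambda>i. w j (x i)" p n] p(3)
          by (simp add: mult.commute)
        then show ?thesis using p(2) p(4)[OF that] by simp
      qed
      then show "restrict x {..<n} \<in> Z n" using p(1) by (auto simp: Z_def)
    qed
    show "(\<lambda>y i. y (i mod n)) ` Z n \<subseteq> fixpoints T X n"
    proof clarify
      fix y assume y: "y \<in> Z n"
      then have "range (\<lambda>i. y (i mod n)) \<subseteq> A" using n by (auto simp: Z_def PiE_iff)
      moreover have "(\<Sum>i<n. w j (y (i mod n))) = 0" if "j \<in> J" for j
        using y that by (simp add: Z_def)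
      ultimately show "(\<lambda>i. y (i mod n)) \<in> fixpoints T X n"
        using n by (auto simp: fixpoints_def X_def pow intro!: exI[of _ n])
    qed
  qed
  moreover have "finite (Z n)" for n
    unfolding Z_def by (rule finite_Collect_conjI) (auto intro: finite_PiE assms)
  ultimately have "realizes T X (\<lambda>n. card (Z n))"
    unfolding realizes_def
    by (metis bij_betw_finite bij_betw_same_card less_eq_Suc_le One_nat_def)
  then show ?thesis unfolding Z_def by (rule realizes_imp_realizable)
qed

lemma sum_Pow_by_card:
  fixes g :: "nat \<Rightarrow> nat"
  shows "(\<Sum>K\<in>Pow {..<n}. g (card K)) = (\<Sum>k\<le>n. (n choose k) * g k)"
proof -
  have "(\<Sum>K\<in>Pow {..<n}. g (card K)) =
      (\<Sum>k\<le>n. \<Sum>K\<in>{K \<in> Pow {..<n}. card K = k}. g (card K))"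
    by (rule sum.group[symmetric]) (auto dest: card_mono[rotated])
  also have "\<dots> = (\<Sum>k\<le>n. (n choose k) * g k)"
    by (rule sum.cong) (use n_subsets[of "{..<n}"] in auto)
  finally show ?thesis .
qed

lemma sum_lessThan_mem_split:
  fixes f :: "bool \<Rightarrow> nat"
  assumes "K \<subseteq> {..<n}"
  shows "(\<Sum>i<n. f (i \<in> K)) = f True * card K + f False * (n - card K)"
proof -
  have "(\<Sum>i<n. f (i \<in> K)) = (\<Sum>i\<in>{..<n} - K. f (i \<in> K)) + (\<Sum>i\<in>K. f (i \<in> K))"
    by (rule sum.subset_diff[OF assms]) simp
  then show ?thesis using assms by (simp add: card_Diff_subset finite_subset)
qed

text \<open>A letter is a pair of a truth value, telling whether its position lies in
  \<open>K\<close>, and a set of pairs \<open>(j, e)\<close>. Collecting a word by \<open>j\<close>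
  instead of by position turns it into \<open>K\<close> and a family of sets \<open>F j\<close> of
  pairs \<open>(i, e)\<close>. Zero weight at \<open>j\<close> fixes the size of \<open>F j\<close>,
  so for given \<open>K\<close> each \<open>j\<close> contributes one binomial coefficient.\<close>

lemma card_zero_sum_words:
  fixes \<beta> \<gamma> :: "'j \<Rightarrow> bool \<Rightarrow> nat"
  assumes "finite J"
  shows "card {x \<in> {..<n} \<rightarrow>\<^sub>E (SIGMA b:UNIV. Pow (SIGMA j:J. {..<\<beta> j b})).
      \<forall>j\<in>J. (\<Sum>i<n. int (card (snd (x i) `` {j})) - int (\<gamma> j (fst (x i)))) = 0} =
    (\<Sum>k\<le>n. (n choose k) * (\<Prod>j\<in>J. (\<beta> j True * k + \<beta> j False * (n - k)) choose
      (\<gamma> j True * k + \<gamma> j False * (n - k))))" (is "card ?Z = _")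
proof -
  \<comment> \<open>\<open>U K j\<close> is the set of admissible \<open>F j\<close>. It involves no
    other index, so for fixed \<open>K\<close> the choices form a full product over
    \<open>J\<close>.\<close>
  define U where "U K j = {S \<in> Pow (SIGMA i:{..<n}. {..<\<beta> j (i \<in> K)}). card S = (\<Sum>i<n. \<gamma> j (i \<in> K))}"
    for K j
  \<comment> \<open>\<open>fw\<close> and its inverse \<open>bw\<close> exchange the roles of
    \<open>i\<close> and \<open>j\<close>. Restricting to \<open>J\<close> and to
    \<open>{..<n}\<close> makes the results extensional, as \<open>Pi\<^sub>E\<close>
    demands.\<close>
  define fw where "fw x = ({i. i < n \<and> fst (x i)}, \<lambda>j\<in>J. {(i, e). i < n \<and> (j, e) \<in> snd (x i)})"
    for x :: "nat \<Rightarrow> bool \<times> ('j \<times> nat) set"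
  define bw :: "nat set \<times> ('j \<Rightarrow> (nat \<times> nat) set) \<Rightarrow> nat \<Rightarrow> bool \<times> ('j \<times> nat) set"
    where "bw = (\<lambda>(K, F). \<lambda>i\<in>{..<n}. (i \<in> K, {(j, e). j \<in> J \<and> (i, e) \<in> F j}))"
  have card_slices: "card S = (\<Sum>i<n. card (S `` {i}))"
    if "S \<subseteq> (SIGMA i:{..<n}. {..<f i})" for S :: "(nat \<times> nat) set" and f
  proof -
    have "S = (SIGMA i:{..<n}. S `` {i})" using that by auto
    then have "card S = card (SIGMA i:{..<n}. S `` {i})" by simp
    moreover have "finite (S `` {i})" for i
      by (rule finite_subset[of _ "{..<f i}"]) (use that in auto)
    ultimately show ?thesis by (simp add: card_SigmaI)
  qed
  have zero_iff: "(\<Sum>i<n. int (f i) - int (g i)) = 0 \<longleftrightarrow> (\<Sum>i<n. f i) = (\<Sum>i<n. g i)" for f g :: "nat \<Rightarrow> nat"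
    unfolding sum_subtractf by (simp only: of_nat_sum[symmetric] right_minus_eq of_nat_eq_iff)
  have "bij_betw fw ?Z (SIGMA K:Pow {..<n}. Pi\<^sub>E J (U K))"
  proof (rule bij_betw_byWitness[where f' = bw])
    show "\<forall>x\<in>?Z. bw (fw x) = x"
    proof
      fix x assume x: "x \<in> ?Z"
      have "bw (fw x) i = x i" for i
      proof (cases "i < n")
        case True
        then have "x i \<in> (SIGMA b:UNIV. Pow (SIGMA j:J. {..<\<beta> j b}))" using x by blast
        then have "snd (x i) \<subseteq> (SIGMA j:J. {..<\<beta> j (fst (x i))})" by auto
        then show ?thesis using True by (auto simp: bw_def fw_def prod_eq_iff)
      next
        case False
        then show ?thesis using x by (auto simp: bw_def fw_def PiE_iff extensional_def)
      qed
      then show "bw (fw x) = x" by blast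
    qed
    show "\<forall>y\<in>SIGMA K:Pow {..<n}. Pi\<^sub>E J (U K). fw (bw y) = y"
    proof clarify
      fix K F assume K: "K \<subseteq> {..<n}" and F: "F \<in> Pi\<^sub>E J (U K)"
      have "snd (fw (bw (K, F))) j = F j" for j
      proof (cases "j \<in> J")
        case True
        then have "F j \<subseteq> (SIGMA i:{..<n}. {..<\<beta> j (i \<in> K)})" using F by (auto simp: U_def PiE_iff)
        then show ?thesis using True by (auto simp: bw_def fw_def)
      next
        case False
        then show ?thesis using F by (auto simp: fw_def PiE_iff extensional_def)
      qed
      then show "fw (bw (K, F)) = (K, F)" using K by (auto simp: fw_def bw_def prod_eq_iff)
    qed
    show "fw ` ?Z \<subseteq> (SIGMA K:Pow {..<n}. Pi\<^sub>E J (U K))"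
    proof clarify
      fix x K F
      assume fw: "(K, F) = fw x" and x: "x \<in> {..<n} \<rightarrow>\<^sub>E (SIGMA b:UNIV. Pow (SIGMA j:J. {..<\<beta> j b}))"
        and z: "\<forall>j\<in>J. (\<Sum>i<n. int (card (snd (x i) `` {j})) - int (\<gamma> j (fst (x i)))) = 0"
      have K: "i \<in> K \<longleftrightarrow> fst (x i)" if "i < n" for i using fw that by (auto simp: fw_def)
      have "F j \<in> U K j" if j: "j \<in> J" for j
      proof -
        have F: "F j = {(i, e). i < n \<and> (j, e) \<in> snd (x i)}" using fw j by (simp add: fw_def)
        have sub: "F j \<subseteq> (SIGMA i:{..<n}. {..<\<beta> j (i \<in> K)})"
        proof clarify
          fix i e assume "(i, e) \<in> F j"
          moreover from this have "x i \<in> (SIGMA b:UNIV. Pow (SIGMA j:J. {..<\<beta> j b}))"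
            using x by (auto simp: F)
          ultimately show "i \<in> {..<n} \<and> e \<in> {..<\<beta> j (i \<in> K)}"
            by (auto simp: F K)
        qed
        \<comment> \<open>The fibre of \<open>F j\<close> over position \<open>i\<close> is the
          slice of the letter \<open>x i\<close> at \<open>j\<close>.\<close>
        have "card (F j) = (\<Sum>i<n. card (snd (x i) `` {j}))"
          unfolding card_slices[OF sub] by (intro sum.cong arg_cong[where f = card]) (auto simp: F)
        also have "\<dots> = (\<Sum>i<n. \<gamma> j (i \<in> K))" using z j unfolding zero_iff by (simp add: K)
        finally show ?thesis using sub by (simp add: U_def)
      qed
      moreover have "F \<in> extensional J" using fw by (simp add: fw_def)
      ultimately show "K \<in> Pow {..<n} \<and> F \<in> Pi\<^sub>E J (U K)" using fw by (auto simp: fw_def PiE_iff)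
    qed
    show "bw ` (SIGMA K:Pow {..<n}. Pi\<^sub>E J (U K)) \<subseteq> ?Z"
    proof
      fix x assume "x \<in> bw ` (SIGMA K:Pow {..<n}. Pi\<^sub>E J (U K))"
      then obtain K F where x: "x = bw (K, F)" and F: "F \<in> Pi\<^sub>E J (U K)" by blast
      have sub: "F j \<subseteq> (SIGMA i:{..<n}. {..<\<beta> j (i \<in> K)})"
        and card: "card (F j) = (\<Sum>i<n. \<gamma> j (i \<in> K))" if "j \<in> J" for j
        using F that by (auto simp: U_def PiE_iff)
      have bw: "bw (K, F) i = (i \<in> K, {(j, e). j \<in> J \<and> (i, e) \<in> F j})" if "i < n" for i
        using that by (simp add: bw_def)
      have "bw (K, F) i \<in> (SIGMA b:UNIV. Pow (SIGMA j:J. {..<\<beta> j b}))" if "i < n" for i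
        using sub by (fastforce simp: bw[OF that])
      moreover have "(\<Sum>i<n. int (card (snd (bw (K, F) i) `` {j})) - int (\<gamma> j (fst (bw (K, F) i)))) = 0"
        if j: "j \<in> J" for j
      proof -
        have "(\<Sum>i<n. card (snd (bw (K, F) i) `` {j})) = (\<Sum>i<n. card (F j `` {i}))"
          by (intro sum.cong arg_cong[where f = card]) (auto simp: bw j)
        also have "\<dots> = (\<Sum>i<n. \<gamma> j (i \<in> K))" using card_slices[OF sub[OF j]] card[OF j] by simp
        finally show ?thesis unfolding zero_iff by (simp add: bw)
      qed
      moreover have "bw (K, F) \<in> extensional {..<n}" by (simp add: bw_def)
      ultimately show "x \<in> ?Z" by (simp add: x PiE_iff)
    qed
  qed
  then have "card ?Z = card (SIGMA K:Pow {..<n}. Pi\<^sub>E J (U K))" by (rule bij_betw_same_card)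
  also have "\<dots> = (\<Sum>K\<in>Pow {..<n}. \<Prod>j\<in>J. card (U K j))"
    by (subst card_SigmaI) (auto simp: card_PiE assms U_def intro!: finite_PiE)
  also have "\<dots> = (\<Sum>K\<in>Pow {..<n}. \<Prod>j\<in>J. (\<beta> j True * card K + \<beta> j False * (n - card K)) choose
      (\<gamma> j True * card K + \<gamma> j False * (n - card K)))"
  proof (intro sum.cong prod.cong refl)
    fix K j assume "K \<in> Pow {..<n}"
    \<comment> \<open>The members of \<open>U K j\<close> are the subsets of prescribed size of a
      set that has \<beta> \<open>j True\<close> elements over each position in \<open>K\<close> and
      \<beta> \<open>j False\<close> over each other one.\<close>
    then show "card (U K j) = (\<beta> j True * card K + \<beta> j False * (n - card K)) choose
        (\<gamma> j True * card K + \<gamma> j False * (n - card K))"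
      by (simp add: U_def n_subsets card_SigmaI sum_lessThan_mem_split)
  qed
  also have "\<dots> = (\<Sum>k\<le>n. (n choose k) * (\<Prod>j\<in>J. (\<beta> j True * k + \<beta> j False * (n - k)) choose
      (\<gamma> j True * k + \<gamma> j False * (n - k))))"
    by (rule sum_Pow_by_card)
  finally show ?thesis .
qed

text \<open>The alphabet of the preceding count is finite, and its weight at \<open>j\<close> is the
  size of the slice at \<open>j\<close> minus \<gamma>, so the sums are numbers of zero-sum words.
  The values at \<open>True\<close> are the coefficients of \<open>k\<close>, those at
  \<open>False\<close> the coefficients of \<open>n - k\<close>.\<close>

lemma realizable_sum_binomial_prod:
  fixes \<beta> \<gamma> :: "'j \<Rightarrow> bool \<Rightarrow> nat"
  assumes "finite J"
  shows "realizable (\<lambda>n. \<Sum>k\<le>n. (n choose k) *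
    (\<Prod>j\<in>J. (\<beta> j True * k + \<beta> j False * (n - k)) choose (\<gamma> j True * k + \<gamma> j False * (n - k))))"
proof -
  have "finite (SIGMA b:UNIV. Pow (SIGMA j:J. {..<\<beta> j b}))" using assms by auto
  from realizable_zero_sum_words[OF this,
      of J "\<lambda>j l. int (card (snd l `` {j})) - int (\<gamma> j (fst l))"]
  show ?thesis by (simp only: card_zero_sum_words[OF assms])
qed

theorem theorem15:
  fixes r s t :: nat
  assumes "r \<ge> 1"
  shows "realizable (\<lambda>n. D n r s t)"
proof -
  \<comment> \<open>One index per binomial factor. Only \<open>r - 1\<close> copies of
    \<open>n choose k\<close> are needed, because the choice of \<open>K\<close> supplies one
    already.\<close>
  define J where "J = {..<r - 1} <+> {..<s} <+> {..<t}"
  \<comment> \<open>The three cases of \<beta> and \<gamma> encode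
    \<open>(k + (n - k)) choose k\<close>, \<open>(2 * k) choose k\<close> and
    \<open>(2 * (n - k)) choose (n - k)\<close>.\<close>
  define \<beta> :: "nat + nat + nat \<Rightarrow> bool \<Rightarrow> nat" where
    "\<beta> = case_sum (\<lambda>_ _. 1) (case_sum (\<lambda>_ b. if b then 2 else 0) (\<lambda>_ b. if b then 0 else 2))"
  define \<gamma> :: "nat + nat + nat \<Rightarrow> bool \<Rightarrow> nat" where
    "\<gamma> = case_sum (\<lambda>_ b. if b then 1 else 0)
       (case_sum (\<lambda>_ b. if b then 1 else 0) (\<lambda>_ b. if b then 0 else 1))"
  have "(n choose k) * (\<Prod>j\<in>J. (\<beta> j True * k + \<beta> j False * (n - k)) choose
      (\<gamma> j True * k + \<gamma> j False * (n - k))) =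
    (n choose k) ^ r * ((2 * k) choose k) ^ s * ((2 * (n - k)) choose (n - k)) ^ t"
    if "k \<le> n" for n k
  proof -
    have "(n choose k) ^ r = (n choose k) * (n choose k) ^ (r - 1)"
      using assms by (simp flip: power_Suc)
    then show ?thesis using that by (simp add: J_def \<beta>_def \<gamma>_def prod.Plus o_def)
  qed
  then have "D n r s t = (\<Sum>k\<le>n. (n choose k) * (\<Prod>j\<in>J.
      (\<beta> j True * k + \<beta> j False * (n - k)) choose (\<gamma> j True * k + \<gamma> j False * (n - k))))" for n
    by (simp add: D_def atLeast0AtMost)
  moreover have "finite J" by (simp add: J_def)
  ultimately show ?thesis by (simp add: realizable_sum_binomial_prod)
qed

end
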